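(* Let $G$ be a Lie group of dimension $n\ge2$ with Lie algebra $\mathfrak g$, $H\in\bigwedge^3\mathfrak g^*$ a closed left-invariant three-form, $g$ a left-invariant pseudo-Riemannian metric, and let $D^0$ be the canonical divergence-free Levi-Civita generalized connection of $(G,H,\mathcal G_g)$. Fix $\delta\in E^*$ and put $\delta_A=\delta(e_A)$. Define $S=S_++S_-$ with $$S_+=-\mathrm{alt}\Big(\delta_1\varepsilon_2(e^2)^2\otimes e^1+\sum_{a=2}^n\delta_a\varepsilon_1(e^1)^2\otimes e^a\Big),$$ $$S_-=-\mathrm{alt}\Big(\delta_{n+1}\varepsilon_{n+2}(e^{n+2})^2\otimes e^{n+1}+\sum_{i=n+2}^{2n}\delta_i\varepsilon_{n+1}(e^{n+1})^2\otimes e^i\Big).$$ Then $D=D^0+S$ is a left-invariant Levi-Civita generalized connection of $(G,H,\mathcal G_g)$ with divergence $\delta_D=\delta$.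
   Context: Let $E=\mathfrak g\oplus\mathfrak g^*$, with scalar product $\langle X+\xi,Y+\eta\rangle=\frac12(\xi(Y)+\eta(X))$ and Dorfman bracket $[X+\xi,Y+\eta]_H=[X,Y]-\mathrm{ad}_X^*\eta+\mathrm{ad}_Y^*\xi+H(X,Y,\cdot)$, where $\mathrm{ad}_X^*\eta=\eta\circ\mathrm{ad}_X$. Put $gX=g(X,\cdot)$, $\mathcal G_g(X+\xi,Y+\eta)=\frac12(g(X,Y)+g^{-1}(\xi,\eta))$ and $E_\pm=\{X\pm gX:X\in\mathfrak g\}$. For a $g$-orthonormal basis $(v_1,\dots,v_n)$ of $\mathfrak g$ put $e_a=v_a+gv_a$, $e_{n+a}=v_a-gv_a$ ($a=1,\dots,n$), let $(e^A)$ be the dual basis of $E^*$ and $\varepsilon_A=\langle e_A,e_A\rangle\in\{\pm1\}$. Put $\mathcal B_{ABC}=\langle[e_A,e_B]_H,e_C\rangle$. For $\sigma\in\mathrm{Sym}^2E_\pm^*\otimes E_\pm^*$, $\mathrm{alt}(\sigma)\in E_\pm^*\otimes\mathfrak{so}(E_\pm)\subset E^*\otimes\mathfrak{so}(E)$ is defined by $\langle\mathrm{alt}(\sigma)_uv,w\rangle=\sigma(u,v,w)-\sigma(u,w,v)$ (extended by zero on $E_\mp$), and $(\alpha^2\otimes\beta)(u,v,w)=\alpha(u)\alpha(v)\beta(w)$. A left-invariant generalized connection is an element $D\in E^*\otimes\mathfrak{so}(E)$, $u\mapsto D_u$. Its torsion is $T(u,v)=D_uv-D_vu-[u,v]_H+(Du)^*v$,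 where $Du\in\mathrm{End}(E)$ is $w\mapsto D_wu$ and $*$ is the adjoint for $\langle\cdot,\cdot\rangle$. $D$ is a Levi-Civita generalized connection of $(G,H,\mathcal G_g)$ if $T=0$ and $D_uE_\pm\subset E_\pm$ for all $u$. Its divergence is $\delta_D(v)=\mathrm{tr}(u\mapsto D_uv)$. The canonical divergence-free Levi-Civita generalized connection $D^0$ is defined by $\langle D^0_{e_A}e_B,e_C\rangle=\omega_{ABC}$ with $\omega_{abc}=\frac13\mathcal B_{abc}$, $\omega_{ijk}=\frac13\mathcal B_{ijk}$, $\omega_{ibc}=\mathcal B_{ibc}$, $\omega_{ajk}=\mathcal B_{ajk}$ for $a,b,c\in\{1,\dots,n\}$, $i,j,k\in\{n+1,\dots,2n\}$, and all other components zero. *)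

theory Defs
  imports "HOL-Analysis.Analysis"
begin

text \<open>
  All objects are left-invariant, so a Lie group enters only through its Lie algebra: a
  finite-dimensional real vector space, here a type \<open>'a::euclidean_space\<close> (its inner product is
  never used as mathematical data), with a bracket \<open>lie\<close>. The dual space is the type of bounded
  linear functionals, which are all the linear functionals in finite dimension.
\<close>

definition lie_bracket :: "('a::euclidean_space \<Rightarrow> 'a \<Rightarrow> 'a) \<Rightarrow> bool" where
  "lie_bracket lie \<longleftrightarrow> bilinear lie \<and> (\<forall>x. lie x x = 0) \<and>
     (\<forall>x y z. lie x (lie y z) + lie y (lie z x) + lie z (lie x y) = 0)"

definition three_form :: "('a::euclidean_space \<Rightarrow> 'a \<Rightarrow> 'a \<Rightarrow> real) \<Rightarrow> bool" where
  "three_form H \<longleftrightarrow>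
     (\<forall>y z. linear (\<lambda>x. H x y z)) \<and> (\<forall>x z. linear (\<lambda>y. H x y z)) \<and> (\<forall>x y. linear (\<lambda>z. H x y z)) \<and>
     (\<forall>x z. H x x z = 0) \<and> (\<forall>x y. H x y y = 0)"

text \<open>
  The exterior derivative of a left-invariant three-form, by the Chevalley--Eilenberg formula
  \<open>dH(x\<^sub>0,\<dots>,x\<^sub>3) = \<Sum>\<^sub>i\<^sub><\<^sub>j (-1)\<^sup>i\<^sup>+\<^sup>j H([x\<^sub>i,x\<^sub>j],\<dots>)\<close>.
\<close>

definition ext_deriv3 ::
  "('a::euclidean_space \<Rightarrow> 'a \<Rightarrow> 'a) \<Rightarrow> ('a \<Rightarrow> 'a \<Rightarrow> 'a \<Rightarrow> real) \<Rightarrow> 'a \<Rightarrow> 'a \<Rightarrow> 'a \<Rightarrow> 'a \<Rightarrow> real" where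
  "ext_deriv3 lie H x y z w =
     - H (lie x y) z w + H (lie x z) y w - H (lie x w) y z
     - H (lie y z) x w + H (lie y w) x z - H (lie z w) x y"

definition closed_three_form ::
  "('a::euclidean_space \<Rightarrow> 'a \<Rightarrow> 'a) \<Rightarrow> ('a \<Rightarrow> 'a \<Rightarrow> 'a \<Rightarrow> real) \<Rightarrow> bool" where
  "closed_three_form lie H \<longleftrightarrow> three_form H \<and> (\<forall>x y z w. ext_deriv3 lie H x y z w = 0)"

definition pseudo_metric :: "('a::euclidean_space \<Rightarrow> 'a \<Rightarrow> real) \<Rightarrow> bool" where
  "pseudo_metric g \<longleftrightarrow> bilinear g \<and> (\<forall>x y. g x y = g y x) \<and> (\<forall>x. (\<forall>y. g x y = 0) \<longrightarrow> x = 0)"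

type_synonym 'a gen_tangent = "'a \<times> ('a \<Rightarrow>\<^sub>L real)"

definition pairing :: "'a::euclidean_space gen_tangent \<Rightarrow> 'a gen_tangent \<Rightarrow> real" where
  "pairing u v = (1 / 2) * (blinfun_apply (snd u) (fst v) + blinfun_apply (snd v) (fst u))"

definition ad_star ::
  "('a::euclidean_space \<Rightarrow> 'a \<Rightarrow> 'a) \<Rightarrow> 'a \<Rightarrow> ('a \<Rightarrow>\<^sub>L real) \<Rightarrow> ('a \<Rightarrow>\<^sub>L real)" where
  "ad_star lie x \<eta> = Blinfun (blinfun_apply \<eta> \<circ> lie x)"

definition dorfman ::
  "('a::euclidean_space \<Rightarrow> 'a \<Rightarrow> 'a) \<Rightarrow> ('a \<Rightarrow> 'a \<Rightarrow> 'a \<Rightarrow> real) \<Rightarrow>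
   'a gen_tangent \<Rightarrow> 'a gen_tangent \<Rightarrow> 'a gen_tangent" where
  "dorfman lie H u v =
     (lie (fst u) (fst v),
      - ad_star lie (fst u) (snd v) + ad_star lie (fst v) (snd u) + Blinfun (H (fst u) (fst v)))"

definition flat :: "('a::euclidean_space \<Rightarrow> 'a \<Rightarrow> real) \<Rightarrow> 'a \<Rightarrow> ('a \<Rightarrow>\<^sub>L real)" where
  "flat g x = Blinfun (g x)"

definition E_plus :: "('a::euclidean_space \<Rightarrow> 'a \<Rightarrow> real) \<Rightarrow> 'a gen_tangent set" where
  "E_plus g = {(x, flat g x) |x. True}"

definition E_minus :: "('a::euclidean_space \<Rightarrow> 'a \<Rightarrow> real) \<Rightarrow> 'a gen_tangent set" where
  "E_minus g = {(x, - flat g x) |x. True}"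

definition gen_metric ::
  "('a::euclidean_space \<Rightarrow> 'a \<Rightarrow> real) \<Rightarrow> 'a gen_tangent \<Rightarrow> 'a gen_tangent \<Rightarrow> real" where
  "gen_metric g u v =
     (1 / 2) * (g (fst u) (fst v) + blinfun_apply (snd u) (inv (flat g) (snd v)))"

lemma flat_apply:
  assumes "pseudo_metric g"
  shows "blinfun_apply (flat g x) y = g x y"
proof -
  have "linear (g x)"
    using assms by (simp add: pseudo_metric_def bilinear_def)
  then have "bounded_linear (g x)"
    by (simp add: linear_conv_bounded_linear)
  then show ?thesis
    by (simp add: flat_def bounded_linear_Blinfun_apply)
qed

lemma bij_flat:
  assumes "pseudo_metric g"
  shows "bij (flat g)"
proof -
  have lin: "linear (\<lambda>x. g x y)" for y
    using assms by (simp add: pseudo_metric_def bilinear_def)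
  have diff: "g (x - y) z = g x z - g y z" for x y z
    using linear_diff[OF lin] .
  have nondeg: "x = 0" if "\<And>y. g x y = 0" for x
    using assms that by (simp add: pseudo_metric_def)
  have inj_g: "x = y" if "\<And>z. g x z = g y z" for x y
    using nondeg[of "x - y"] that by (simp add: diff)
  have inj: "inj (flat g)"
    by (rule injI) (metis assms flat_apply inj_g)
  define L where "L x = (\<Sum>b\<in>Basis. g x b *\<^sub>R b)" for x
  have L_inner: "L x \<bullet> b = g x b" if "b \<in> Basis" for x b
    using that by (simp add: L_def)
  have "linear L"
    unfolding L_def
    by (intro linear_compose_sum ballI linear_compose[OF lin, unfolded o_def])
      (auto intro: linearI simp: scaleR_add_left)
  moreover have "inj L"
  proof (rule injI)
    fix x y assume "L x = L y"
    then have "flat g x = flat g y"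
      by (intro blinfun_euclidean_eqI) (metis L_inner assms flat_apply)
    then show "x = y"
      using inj by (simp add: inj_eq)
  qed
  ultimately have surj_L: "surj L"
    by (rule linear_injective_imp_surjective) simp
  have "\<exists>x. \<xi> = flat g x" for \<xi>
  proof -
    obtain x where x: "(\<Sum>b\<in>Basis. blinfun_apply \<xi> b *\<^sub>R b) = L x"
      using surj_L by blast
    have "blinfun_apply \<xi> b = g x b" if "b \<in> Basis" for b
      using that arg_cong[OF x, of "\<lambda>z. z \<bullet> b"] by (simp add: L_inner)
    then have "\<xi> = flat g x"
      by (intro blinfun_euclidean_eqI) (simp add: flat_apply assms)
    then show ?thesis ..
  qed
  then have "surj (flat g)"
    by blast
  with inj show ?thesis
    by (rule bijI)
qed

text \<open>
  The notions below depend on the generalized metric only through its eigenbundles, that is,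
  through \<open>E_plus g\<close> and \<open>E_minus g\<close>.
\<close>

lemma gen_metric_eigen_iff:
  assumes g: "pseudo_metric g" and s: "s = 1 \<or> s = -1"
  shows "(\<forall>w. gen_metric g (x, \<xi>) w = s * pairing (x, \<xi>) w) \<longleftrightarrow> \<xi> = s *\<^sub>R flat g x"
proof
  assume eq: "\<forall>w. gen_metric g (x, \<xi>) w = s * pairing (x, \<xi>) w"
  have "flat g 0 = 0"
    using linear_0[of "\<lambda>x. g x y" for y] g
    by (intro blinfun_eqI) (simp add: flat_apply[OF g] pseudo_metric_def bilinear_def linear_0)
  then have "inv (flat g) 0 = 0"
    using bij_flat[OF g] by (metis bij_inv_eq_iff)
  then have "g x y = s * blinfun_apply \<xi> y" for y
    using eq[rule_format, of "(y, 0)"] by (simp add: gen_metric_def pairing_def)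
  then show "\<xi> = s *\<^sub>R flat g x"
    using s by (intro blinfun_eqI) (auto simp: flat_apply[OF g] scaleR_blinfun.rep_eq)
next
  assume \<xi>: "\<xi> = s *\<^sub>R flat g x"
  have "gen_metric g (x, \<xi>) (y, \<eta>) = s * pairing (x, \<xi>) (y, \<eta>)" for y \<eta>
  proof -
    obtain z where z: "\<eta> = flat g z"
      using bij_flat[OF g] by (metis bij_pointE)
    have "inv (flat g) \<eta> = z"
      using z bij_flat[OF g] by (simp add: bij_is_inj inv_f_f)
    moreover have "g x z = g z x"
      using g by (simp add: pseudo_metric_def)
    ultimately show ?thesis
      using s by (auto simp: gen_metric_def pairing_def \<xi> z flat_apply[OF g] scaleR_blinfun.rep_eq)
  qed
  then show "\<forall>w. gen_metric g (x, \<xi>) w = s * pairing (x, \<xi>) w"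
    by auto
qed

lemma E_plus_eq_eigenspace:
  assumes "pseudo_metric g"
  shows "E_plus g = {u. \<forall>w. gen_metric g u w = pairing u w}"
  using gen_metric_eigen_iff[OF assms, of 1] by (auto simp: E_plus_def)

lemma E_minus_eq_eigenspace:
  assumes "pseudo_metric g"
  shows "E_minus g = {u. \<forall>w. gen_metric g u w = - pairing u w}"
  using gen_metric_eigen_iff[OF assms, of "-1"] by (auto simp: E_minus_def)

definition pairing_adjoint ::
  "('a::euclidean_space gen_tangent \<Rightarrow> 'a gen_tangent) \<Rightarrow> 'a gen_tangent \<Rightarrow> 'a gen_tangent" where
  "pairing_adjoint f = (THE f'. \<forall>u v. pairing (f u) v = pairing u (f' v))"

text \<open>The trace of an endomorphism, computed in an arbitrarily chosen basis.\<close>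

definition endo_trace :: "('b::real_vector \<Rightarrow> 'b) \<Rightarrow> real" where
  "endo_trace f =
     (let B = (SOME B. finite B \<and> independent B \<and> span B = UNIV)
      in \<Sum>b\<in>B. representation B (f b) b)"

definition gen_connection ::
  "('a::euclidean_space gen_tangent \<Rightarrow> 'a gen_tangent \<Rightarrow> 'a gen_tangent) \<Rightarrow> bool" where
  "gen_connection D \<longleftrightarrow> bilinear D \<and> (\<forall>u v w. pairing (D u v) w = - pairing v (D u w))"

definition torsion ::
  "('a::euclidean_space \<Rightarrow> 'a \<Rightarrow> 'a) \<Rightarrow> ('a \<Rightarrow> 'a \<Rightarrow> 'a \<Rightarrow> real) \<Rightarrow>
   ('a gen_tangent \<Rightarrow> 'a gen_tangent \<Rightarrow> 'a gen_tangent) \<Rightarrow>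
   'a gen_tangent \<Rightarrow> 'a gen_tangent \<Rightarrow> 'a gen_tangent" where
  "torsion lie H D u v = D u v - D v u - dorfman lie H u v + pairing_adjoint (\<lambda>w. D w u) v"

definition levi_civita ::
  "('a::euclidean_space \<Rightarrow> 'a \<Rightarrow> 'a) \<Rightarrow> ('a \<Rightarrow> 'a \<Rightarrow> 'a \<Rightarrow> real) \<Rightarrow> ('a \<Rightarrow> 'a \<Rightarrow> real) \<Rightarrow>
   ('a gen_tangent \<Rightarrow> 'a gen_tangent \<Rightarrow> 'a gen_tangent) \<Rightarrow> bool" where
  "levi_civita lie H g D \<longleftrightarrow> gen_connection D \<and> (\<forall>u v. torsion lie H D u v = 0) \<and>
     (\<forall>u. D u ` E_plus g \<subseteq> E_plus g \<and> D u ` E_minus g \<subseteq> E_minus g)"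

definition divergence ::
  "('a::euclidean_space gen_tangent \<Rightarrow> 'a gen_tangent \<Rightarrow> 'a gen_tangent) \<Rightarrow> 'a gen_tangent \<Rightarrow> real"
  where "divergence D v = endo_trace (\<lambda>u. D u v)"

text \<open>
  Frames are indexed by natural numbers starting at 1; values of \<open>v\<close> outside \<open>{1..DIM('a)}\<close> and of
  the frame outside \<open>{1..2 * DIM('a)}\<close> are irrelevant.
\<close>

definition orthonormal_basis :: "('a::euclidean_space \<Rightarrow> 'a \<Rightarrow> real) \<Rightarrow> (nat \<Rightarrow> 'a) \<Rightarrow> bool" where
  "orthonormal_basis g v \<longleftrightarrow>
     inj_on v {1..DIM('a)} \<and> independent (v ` {1..DIM('a)}) \<and> span (v ` {1..DIM('a)}) = UNIV \<and>
     (\<forall>a\<in>{1..DIM('a)}. g (v a) (v a) = 1 \<or> g (v a) (v a) = -1) \<and>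
     (\<forall>a\<in>{1..DIM('a)}. \<forall>b\<in>{1..DIM('a)}. a \<noteq> b \<longrightarrow> g (v a) (v b) = 0)"

definition frame ::
  "('a::euclidean_space \<Rightarrow> 'a \<Rightarrow> real) \<Rightarrow> (nat \<Rightarrow> 'a) \<Rightarrow> nat \<Rightarrow> 'a gen_tangent" where
  "frame g v A =
     (if A \<le> DIM('a) then (v A, flat g (v A))
      else (v (A - DIM('a)), - flat g (v (A - DIM('a)))))"

text \<open>The dual basis: \<open>coframe g v A u\<close> is the coordinate of \<open>u\<close> along \<open>frame g v A\<close>.\<close>

definition coframe ::
  "('a::euclidean_space \<Rightarrow> 'a \<Rightarrow> real) \<Rightarrow> (nat \<Rightarrow> 'a) \<Rightarrow> nat \<Rightarrow> 'a gen_tangent \<Rightarrow> real" where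
  "coframe g v A u = representation (frame g v ` {1..2 * DIM('a)}) u (frame g v A)"

definition frame_sign :: "('a::euclidean_space \<Rightarrow> 'a \<Rightarrow> real) \<Rightarrow> (nat \<Rightarrow> 'a) \<Rightarrow> nat \<Rightarrow> real" where
  "frame_sign g v A = pairing (frame g v A) (frame g v A)"

definition dorfman_coeff ::
  "('a::euclidean_space \<Rightarrow> 'a \<Rightarrow> 'a) \<Rightarrow> ('a \<Rightarrow> 'a \<Rightarrow> 'a \<Rightarrow> real) \<Rightarrow> ('a \<Rightarrow> 'a \<Rightarrow> real) \<Rightarrow>
   (nat \<Rightarrow> 'a) \<Rightarrow> nat \<Rightarrow> nat \<Rightarrow> nat \<Rightarrow> real" where
  "dorfman_coeff lie H g v A B C = pairing (dorfman lie H (frame g v A) (frame g v B)) (frame g v C)"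

definition canonical_coeff ::
  "('a::euclidean_space \<Rightarrow> 'a \<Rightarrow> 'a) \<Rightarrow> ('a \<Rightarrow> 'a \<Rightarrow> 'a \<Rightarrow> real) \<Rightarrow> ('a \<Rightarrow> 'a \<Rightarrow> real) \<Rightarrow>
   (nat \<Rightarrow> 'a) \<Rightarrow> nat \<Rightarrow> nat \<Rightarrow> nat \<Rightarrow> real" where
  "canonical_coeff lie H g v A B C =
     (let P = {1..DIM('a)}; M = {DIM('a) + 1..2 * DIM('a)} in
      if A \<in> P \<and> B \<in> P \<and> C \<in> P \<or> A \<in> M \<and> B \<in> M \<and> C \<in> M
        then (1 / 3) * dorfman_coeff lie H g v A B C
      else if A \<in> M \<and> B \<in> P \<and> C \<in> P \<or> A \<in> P \<and> B \<in> M \<and> C \<in> M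
        then dorfman_coeff lie H g v A B C
      else 0)"

definition canonical_connection ::
  "('a::euclidean_space \<Rightarrow> 'a \<Rightarrow> 'a) \<Rightarrow> ('a \<Rightarrow> 'a \<Rightarrow> 'a \<Rightarrow> real) \<Rightarrow> ('a \<Rightarrow> 'a \<Rightarrow> real) \<Rightarrow>
   (nat \<Rightarrow> 'a) \<Rightarrow> 'a gen_tangent \<Rightarrow> 'a gen_tangent \<Rightarrow> 'a gen_tangent" where
  "canonical_connection lie H g v =
     (THE D. bilinear D \<and>
        (\<forall>A\<in>{1..2 * DIM('a)}. \<forall>B\<in>{1..2 * DIM('a)}. \<forall>C\<in>{1..2 * DIM('a)}.
           pairing (D (frame g v A) (frame g v B)) (frame g v C) = canonical_coeff lie H g v A B C))"

text \<open>
  A tensor in \<open>Sym\<^sup>2 E\<^sub>\<plusminus>\<^sup>* \<otimes> E\<^sub>\<plusminus>\<^sup>*\<close> is represented by its extension by zero to a trilinear form on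
  the whole of \<open>E\<close>. The covectors \<open>coframe g v A\<close> with \<open>A \<le> DIM('a)\<close> vanish on \<open>E\<^sub>-\<close> and those with
  \<open>A > DIM('a)\<close> vanish on \<open>E\<^sub>+\<close>, so they are already extended by zero.
\<close>

definition alt ::
  "('a::euclidean_space gen_tangent \<Rightarrow> 'a gen_tangent \<Rightarrow> 'a gen_tangent \<Rightarrow> real) \<Rightarrow>
   'a gen_tangent \<Rightarrow> 'a gen_tangent \<Rightarrow> 'a gen_tangent" where
  "alt \<sigma> u v = (THE x. \<forall>w. pairing x w = \<sigma> u v w - \<sigma> u w v)"

definition sq_tensor :: "('b \<Rightarrow> real) \<Rightarrow> ('b \<Rightarrow> real) \<Rightarrow> 'b \<Rightarrow> 'b \<Rightarrow> 'b \<Rightarrow> real" where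
  "sq_tensor \<alpha> \<beta> u v w = \<alpha> u * \<alpha> v * \<beta> w"

definition S_plus ::
  "('a::euclidean_space \<Rightarrow> 'a \<Rightarrow> real) \<Rightarrow> (nat \<Rightarrow> 'a) \<Rightarrow> ('a gen_tangent \<Rightarrow> real) \<Rightarrow>
   'a gen_tangent \<Rightarrow> 'a gen_tangent \<Rightarrow> 'a gen_tangent" where
  "S_plus g v \<delta> u x =
     (let n = DIM('a); e = frame g v; \<theta> = coframe g v; \<epsilon> = frame_sign g v in
      - alt (\<lambda>u x w. \<delta> (e 1) * \<epsilon> 2 * sq_tensor (\<theta> 2) (\<theta> 1) u x w
               + (\<Sum>a = 2..n. \<delta> (e a) * \<epsilon> 1 * sq_tensor (\<theta> 1) (\<theta> a) u x w)) u x)"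

definition S_minus ::
  "('a::euclidean_space \<Rightarrow> 'a \<Rightarrow> real) \<Rightarrow> (nat \<Rightarrow> 'a) \<Rightarrow> ('a gen_tangent \<Rightarrow> real) \<Rightarrow>
   'a gen_tangent \<Rightarrow> 'a gen_tangent \<Rightarrow> 'a gen_tangent" where
  "S_minus g v \<delta> u x =
     (let n = DIM('a); e = frame g v; \<theta> = coframe g v; \<epsilon> = frame_sign g v in
      - alt (\<lambda>u x w. \<delta> (e (n + 1)) * \<epsilon> (n + 2) * sq_tensor (\<theta> (n + 2)) (\<theta> (n + 1)) u x w
               + (\<Sum>i = n + 2..2 * n. \<delta> (e i) * \<epsilon> (n + 1) * sq_tensor (\<theta> (n + 1)) (\<theta> i) u x w)) u x)"

end

theory Submission
  imports Defs
begin

text \<open>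
  By nondegeneracy of the pairing a connection \<open>D\<close> amounts to the trilinear form
  \<open>\<tau>(u,x,w) = \<langle>D\<^sub>u x, w\<rangle>\<close>, and \<open>D\<close> is Levi-Civita iff \<open>\<tau>\<close> is skew in its last two arguments,
  vanishes on \<open>E \<otimes> E\<^sub>+ \<otimes> E\<^sub>-\<close>, and has cyclic sum \<open>\<B>(u,x,w) = \<langle>[u,x]\<^sub>H, w\<rangle>\<close>. The form of
  \<open>D\<^sup>0\<close> has these properties because \<open>\<B>\<close> is totally skew; the form of \<open>S\<close> has cyclic sum zero
  because alternating a tensor symmetric in its first two arguments kills the cyclic sum. The
  trace of \<open>D\<^sup>0\<close> vanishes by skewness, and in the trace of \<open>S\<close> the term built from
  \<open>\<epsilon>\<^sub>b (e\<^sup>b)\<^sup>2 \<otimes> e\<^sup>a\<close> with \<open>b \<noteq> a\<close> contributes exactly \<open>e\<^sup>a\<close>.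
\<close>

section \<open>Trilinear forms and their closure properties\<close>

definition trilinear :: "('b::real_vector \<Rightarrow> 'b \<Rightarrow> 'b \<Rightarrow> real) \<Rightarrow> bool" where
  "trilinear \<tau> \<longleftrightarrow>
     (\<forall>y z. linear (\<lambda>x. \<tau> x y z)) \<and> (\<forall>x z. linear (\<lambda>y. \<tau> x y z)) \<and> (\<forall>x y. linear (\<lambda>z. \<tau> x y z))"

lemma
  assumes "trilinear \<tau>"
  shows trilinear_add_first: "\<tau> (x + x') y z = \<tau> x y z + \<tau> x' y z"
    and trilinear_add_second: "\<tau> x (y + y') z = \<tau> x y z + \<tau> x y' z"
    and trilinear_add_third: "\<tau> x y (z + z') = \<tau> x y z + \<tau> x y z'"
    and trilinear_scale_first: "\<tau> (c *\<^sub>R x) y z = c * \<tau> x y z"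
    and trilinear_scale_second: "\<tau> x (c *\<^sub>R y) z = c * \<tau> x y z"
    and trilinear_0_first: "\<tau> 0 y z = 0"
    and trilinear_0_second: "\<tau> x 0 z = 0"
    and trilinear_0_third: "\<tau> x y 0 = 0"
proof -
  have "linear (\<lambda>x. \<tau> x y z)" "linear (\<lambda>y. \<tau> x y z)" "linear (\<lambda>z. \<tau> x y z)" for x y z
    using assms by (auto simp: trilinear_def)
  note lin = this
  show "\<tau> (x + x') y z = \<tau> x y z + \<tau> x' y z" "\<tau> (c *\<^sub>R x) y z = c * \<tau> x y z"
    using linear_add[OF lin(1)] linear_scale[OF lin(1)] by simp_all
  show "\<tau> x (y + y') z = \<tau> x y z + \<tau> x y' z" "\<tau> x (c *\<^sub>R y) z = c * \<tau> x y z"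
    using linear_add[OF lin(2)] linear_scale[OF lin(2)] by simp_all
  show "\<tau> x y (z + z') = \<tau> x y z + \<tau> x y z'"
    using linear_add[OF lin(3)] .
  show "\<tau> 0 y z = 0" "\<tau> x 0 z = 0" "\<tau> x y 0 = 0"
    using linear_0[OF lin(1)] linear_0[OF lin(2)] linear_0[OF lin(3)] by simp_all
qed

lemma trilinear_add:
  assumes "trilinear \<sigma>" "trilinear \<tau>"
  shows "trilinear (\<lambda>x y z. \<sigma> x y z + \<tau> x y z)"
  using assms unfolding trilinear_def by (auto intro!: linear_compose_add)

lemma trilinear_minus:
  assumes "trilinear \<sigma>"
  shows "trilinear (\<lambda>x y z. - \<sigma> x y z)"
  using assms unfolding trilinear_def by (auto intro!: linear_compose_neg)

lemma trilinear_scale: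
  assumes "trilinear \<sigma>"
  shows "trilinear (\<lambda>x y z. c * \<sigma> x y z)"
  using assms unfolding trilinear_def
  by (auto intro!: linear_compose_scale_right[where 'b = real, unfolded real_scaleR_def])

lemma trilinear_sum:
  assumes "\<And>a. a \<in> J \<Longrightarrow> trilinear (\<sigma> a)"
  shows "trilinear (\<lambda>x y z. \<Sum>a\<in>J. \<sigma> a x y z)"
  using assms unfolding trilinear_def by (auto intro!: linear_compose_sum)

lemma trilinear_compose:
  assumes "trilinear \<tau>" "linear f" "linear h" "linear k"
  shows "trilinear (\<lambda>x y z. \<tau> (f x) (h y) (k z))"
  using assms unfolding trilinear_def
  by (auto intro: linear_compose[unfolded o_def])

lemma trilinear_swap:
  assumes "trilinear \<tau>"
  shows "trilinear (\<lambda>x y z. \<tau> x z y)"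
  using assms unfolding trilinear_def by auto

lemma trilinear_sq_tensor:
  assumes "linear \<alpha>" "linear \<beta>"
  shows "trilinear (sq_tensor \<alpha> \<beta>)"
  using assms unfolding trilinear_def sq_tensor_def
  by (auto intro!: linearI simp: linear_add linear_scale algebra_simps)

section \<open>Orthonormal frames of an indefinite scalar product\<close>

locale orthonormal_frame =
  fixes p :: "'b::real_vector \<Rightarrow> 'b \<Rightarrow> real" and e :: "nat \<Rightarrow> 'b" and I :: "nat set"
  assumes bilinear_p: "bilinear p" and sym: "p x y = p y x" and finite_I: "finite I"
    and unit: "A \<in> I \<Longrightarrow> p (e A) (e A) = 1 \<or> p (e A) (e A) = -1"
    and orthogonal: "\<lbrakk>A \<in> I; B \<in> I; A \<noteq> B\<rbrakk> \<Longrightarrow> p (e A) (e B) = 0"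
    and span_e: "span (e ` I) = UNIV"
begin

text \<open>The sign \<open>p (e A) (e A)\<close> is its own inverse, so multiplying by it turns the
  scalar product with \<open>e A\<close> into the coefficient of \<open>u\<close> along
  \<open>e A\<close>.\<close>

definition coord :: "nat \<Rightarrow> 'b \<Rightarrow> real" where
  "coord A u = p (e A) (e A) * p u (e A)"

definition proj :: "nat set \<Rightarrow> 'b \<Rightarrow> 'b" where
  "proj J u = (\<Sum>A\<in>J. coord A u *\<^sub>R e A)"

lemma linear_p_left: "linear (\<lambda>x. p x y)"
  using bilinear_p by (auto simp: bilinear_def)

lemma linear_coord: "linear (coord A)"
  unfolding coord_def
  by (rule linear_compose_scale_right[where 'b = real, unfolded real_scaleR_def])
    (rule linear_p_left)

lemma linear_proj: "linear (proj J)"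
  unfolding proj_def
  by (intro linear_compose_sum ballI linearI)
    (simp_all add: linear_add[OF linear_coord] linear_scale[OF linear_coord] scaleR_add_left)

lemma unit_square: "A \<in> I \<Longrightarrow> p (e A) (e A) * p (e A) (e A) = 1"
  using unit[of A] by auto

lemma coord_frame:
  "\<lbrakk>A \<in> I; B \<in> I\<rbrakk> \<Longrightarrow> coord A (e B) = (if A = B then 1 else 0)"
  by (auto simp: coord_def unit_square orthogonal)

lemma proj_frame:
  assumes "J \<subseteq> I" "A \<in> I"
  shows "proj J (e A) = (if A \<in> J then e A else 0)"
proof -
  have "proj J (e A) = (\<Sum>B\<in>J. if B = A then e A else 0)"
    unfolding proj_def by (rule sum.cong) (use assms in \<open>auto simp: coord_frame subset_iff\<close>)
  then show ?thesis
    using finite_subset[OF assms(1) finite_I] by (simp add: sum.delta)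
qed

text \<open>Both sides are linear in \<open>u\<close> and agree on the frame, which spans. Linear
  independence is not assumed; it is derived below from the coordinates.\<close>

lemma expansion: "(\<Sum>A\<in>I. coord A u *\<^sub>R e A) = u"
proof -
  have "proj I u = id u"
    by (rule linear_eq_on_span[OF linear_proj linear_id, of "e ` I"])
      (auto simp: proj_frame span_e)
  then show ?thesis
    by (simp add: proj_def)
qed

lemma proj_add_proj:
  assumes "I = J \<union> K" "J \<inter> K = {}"
  shows "proj J u + proj K u = u"
  using expansion[of u] assms finite_I by (simp add: proj_def sum.union_disjoint)

lemma linear_expansion:
  assumes "linear \<phi>"
  shows "\<phi> u = (\<Sum>A\<in>I. coord A u *\<^sub>R \<phi> (e A))"
  by (subst expansion[symmetric]) (simp add: linear_sum[OF assms] linear_scale[OF assms])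

text \<open>Nondegeneracy of \<open>p\<close>: by \<open>expansion\<close> a vector is determined by
  its scalar products with the frame.\<close>

lemma eqI_p: "(\<And>w. p x w = p y w) \<Longrightarrow> x = y"
  by (subst (1 2) expansion[symmetric]) (simp add: coord_def)

lemma eqI_frame: "(\<And>A. A \<in> I \<Longrightarrow> p x (e A) = p y (e A)) \<Longrightarrow> x = y"
  by (subst (1 2) expansion[symmetric]) (simp add: coord_def)

text \<open>The representing vector is \<open>\<phi>\<close> with its index raised: its coordinate
  along \<open>e A\<close> is \<open>\<phi> (e A)\<close> times the sign of
  \<open>e A\<close>.\<close>

lemma riesz:
  assumes "linear \<phi>"
  obtains x where "\<And>w. p x w = \<phi> w"
proof
  fix w
  show "p (\<Sum>A\<in>I. (p (e A) (e A) * \<phi> (e A)) *\<^sub>R e A) w = \<phi> w"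
    by (subst linear_expansion[OF assms, of w])
      (simp add: linear_sum[OF linear_p_left] linear_scale[OF linear_p_left] coord_def
        sym[of w] algebra_simps)
qed

text \<open>Pointwise \<open>riesz\<close> and choice give \<open>D\<close>; nondegeneracy then
  carries linearity in \<open>u\<close> and \<open>x\<close> over from \<open>\<tau>\<close> to
  \<open>D\<close>.\<close>

lemma riesz_bilinear:
  assumes "trilinear \<tau>"
  shows "\<exists>D. bilinear D \<and> (\<forall>u x w. p (D u x) w = \<tau> u x w)"
proof -
  have "\<exists>y. \<forall>w. p y w = \<tau> u x w" for u x
    using assms riesz[of "\<tau> u x"] unfolding trilinear_def by metis
  then obtain D where D: "\<And>u x w. p (D u x) w = \<tau> u x w"
    by metis
  moreover have "bilinear D"
    unfolding bilinear_def
    by (auto intro!: linearI eqI_p simp: D linear_add[OF linear_p_left]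
        linear_scale[OF linear_p_left] trilinear_add_first[OF assms]
        trilinear_add_second[OF assms] trilinear_scale_first[OF assms]
        trilinear_scale_second[OF assms])
  ultimately show ?thesis
    by blast
qed

lemma bilinear_from_form:
  assumes "trilinear \<tau>" "\<And>u x w. p (D u x) w = \<tau> u x w"
  shows "bilinear D"
proof -
  obtain D' where D': "bilinear D'" "\<And>u x w. p (D' u x) w = \<tau> u x w"
    using riesz_bilinear[OF assms(1)] by blast
  have "D = D'"
    by (intro ext eqI_p) (simp add: assms(2) D'(2))
  with D'(1) show ?thesis
    by simp
qed

lemma bilinear_eq_frame:
  assumes "bilinear D" "bilinear D'"
    and "\<And>A B C. \<lbrakk>A \<in> I; B \<in> I; C \<in> I\<rbrakk> \<Longrightarrow> p (D (e A) (e B)) (e C) = p (D' (e A) (e B)) (e C)"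
  shows "D = D'"
proof (intro ext)
  fix u x
  show "D u x = D' u x"
    by (rule bilinear_eq[OF assms(1,2), of UNIV "e ` I" UNIV "e ` I"])
      (auto simp: span_e intro!: eqI_frame assms(3))
qed

lemma inj_on_frame: "inj_on e I"
proof (rule inj_onI)
  fix A B assume "A \<in> I" "B \<in> I" "e A = e B"
  then show "A = B"
    using coord_frame[of A A] coord_frame[of A B] by (auto split: if_splits)
qed

text \<open>Applying \<open>coord A\<close> to a vanishing combination extracts its coefficient at
  \<open>e A\<close>.\<close>

lemma independent_frame: "independent (e ` I)"
proof (rule independent_if_scalars_zero)
  show "finite (e ` I)"
    using finite_I by simp
  fix f x assume 0: "(\<Sum>y\<in>e ` I. f y *\<^sub>R y) = 0" and "x \<in> e ` I"
  then obtain A where A: "A \<in> I" "x = e A"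
    by auto
  have "0 = coord A (\<Sum>B\<in>I. f (e B) *\<^sub>R e B)"
    using 0 by (simp add: sum.reindex[OF inj_on_frame] linear_0[OF linear_coord])
  also have "\<dots> = (\<Sum>B\<in>I. if A = B then f (e B) else 0)"
    by (simp add: linear_sum[OF linear_coord] linear_scale[OF linear_coord] coord_frame A(1)
        if_distrib cong: if_cong sum.cong)
  also have "\<dots> = f x"
    using A finite_I by (simp add: sum.delta')
  finally show "f x = 0"
    by simp
qed

text \<open>Links \<open>coord\<close> to the library notion of coordinates, through which
  \<open>coframe\<close> is defined.\<close>

lemma representation_frame:
  assumes "A \<in> I"
  shows "representation (e ` I) u (e A) = coord A u"
proof -
  have "representation (e ` I) u (e A) = (\<Sum>B\<in>I. coord B u * representation (e ` I) (e B) (e A))"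
    by (subst expansion[symmetric])
      (simp add: representation_sum representation_scale independent_frame span_e)
  also have "\<dots> = (\<Sum>B\<in>I. if B = A then coord B u else 0)"
    using assms by (intro sum.cong refl)
      (auto simp: representation_basis independent_frame inj_on_eq_iff[OF inj_on_frame])
  finally show ?thesis
    using assms finite_I by (simp add: sum.delta)
qed

text \<open>Basis independence of the trace: expand in the frame, swap the two sums, and recombine
  the expansion of \<open>f (e A)\<close> in the arbitrary basis \<open>B\<close>.\<close>

lemma endo_trace_frame:
  assumes f: "linear f"
  shows "endo_trace f = (\<Sum>A\<in>I. coord A (f (e A)))"
proof -
  define B :: "'b set" where "B = (SOME B. finite B \<and> independent B \<and> span B = UNIV)"
  \<comment> \<open>The frame is a finite basis, so the choice made in \<open>endo_trace\<close>
    really yields one.\<close>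
  have "finite B \<and> independent B \<and> span B = UNIV"
    unfolding B_def
    by (rule someI[of _ "e ` I"]) (simp add: finite_I independent_frame span_e)
  then have B: "finite B" "independent B" "span B = UNIV"
    by auto
  let ?r = "representation B"
  have "?r (f b) b = (\<Sum>A\<in>I. coord A b * ?r (f (e A)) b)" for b
    by (subst linear_expansion[OF f])
      (simp add: representation_sum representation_scale B(2,3))
  then have "endo_trace f = (\<Sum>b\<in>B. \<Sum>A\<in>I. coord A b * ?r (f (e A)) b)"
    by (simp add: endo_trace_def B_def[symmetric] Let_def)
  also have "\<dots> = (\<Sum>A\<in>I. \<Sum>b\<in>B. coord A b * ?r (f (e A)) b)"
    by (rule sum.swap)
  also have "\<dots> = (\<Sum>A\<in>I. coord A (\<Sum>b\<in>B. ?r (f (e A)) b *\<^sub>R b))"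
    by (simp add: linear_sum[OF linear_coord] linear_scale[OF linear_coord] mult.commute)
  also have "\<dots> = (\<Sum>A\<in>I. coord A (f (e A)))"
    using B by (simp add: sum_representation_eq)
  finally show ?thesis .
qed

section \<open>The tensors alternated in \<open>S\<close> and their contractions\<close>

text \<open>
  The common shape of the tensors alternated in \<open>S\<^sub>+\<close> (with \<open>j = 1\<close>, \<open>k = 2\<close>) and in \<open>S\<^sub>-\<close> (with
  \<open>j = n + 1\<close>, \<open>k = n + 2\<close>).
\<close>

definition trace_form :: "('b \<Rightarrow> real) \<Rightarrow> nat \<Rightarrow> nat \<Rightarrow> nat set \<Rightarrow> 'b \<Rightarrow> 'b \<Rightarrow> 'b \<Rightarrow> real" where
  "trace_form \<delta> j k J u x w =
     \<delta> (e j) * p (e k) (e k) * sq_tensor (coord k) (coord j) u x w +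
     (\<Sum>a\<in>J. \<delta> (e a) * p (e j) (e j) * sq_tensor (coord j) (coord a) u x w)"

lemma trilinear_trace_form: "trilinear (trace_form \<delta> j k J)"
  unfolding trace_form_def
  by (intro trilinear_add trilinear_sum trilinear_scale trilinear_sq_tensor linear_coord)

text \<open>This symmetry is what makes the cyclic sum of the alternated tensor vanish.\<close>

lemma trace_form_commute: "trace_form \<delta> j k J u x w = trace_form \<delta> j k J x u w"
  by (simp add: trace_form_def sq_tensor_def mult.commute mult.left_commute)

text \<open>In every summand the second and third slots carry coordinates with index in
  \<open>insert j J\<close>; \<open>k \<in> J\<close> accounts for \<open>coord k\<close>. It serves
  to kill arguments from the opposite eigenbundle.\<close>

lemma trace_form_eq_0:
  assumes "k \<in> J" "\<And>A. A \<in> insert j J \<Longrightarrow> coord A x = 0"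
  shows "trace_form \<delta> j k J u x w = 0" "trace_form \<delta> j k J u w x = 0"
  using assms by (simp_all add: trace_form_def sq_tensor_def)

lemma sum_coord_square:
  assumes "j \<in> I"
  shows "(\<Sum>A\<in>I. p (e A) (e A) * (coord j (e A) * coord j (e A))) = p (e j) (e j)"
proof -
  have "(\<Sum>A\<in>I. p (e A) (e A) * (coord j (e A) * coord j (e A)))
      = (\<Sum>A\<in>I. if A = j then p (e A) (e A) else 0)"
    using assms by (intro sum.cong) (auto simp: coord_frame)
  then show ?thesis
    using assms finite_I by (simp add: sum.delta)
qed

text \<open>In every summand the first and third slots carry coordinates with different indices,
  \<open>k\<close> and \<open>j\<close> or \<open>j\<close> and \<open>a\<close>, and a single frame
  vector cannot have both nonzero.\<close>

lemma trace_form_off_diagonal: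
  assumes "j \<notin> J" "k \<in> J" "insert j J \<subseteq> I" "A \<in> I"
  shows "trace_form \<delta> j k J (e A) x (e A) = 0"
proof -
  have 0: "coord B (e A) = 0 \<or> coord C (e A) = 0" if "B \<in> I" "C \<in> I" "B \<noteq> C" for B C
    using that assms(4) by (simp add: coord_frame)
  have "coord k (e A) = 0 \<or> coord j (e A) = 0"
    using 0[of k j] assms by auto
  moreover have "coord j (e A) = 0 \<or> coord a (e A) = 0" if "a \<in> J" for a
    using 0[of j a] assms that by auto
  ultimately show ?thesis
    by (auto simp: trace_form_def sq_tensor_def intro!: sum.neutral)
qed

text \<open>Contracting the square of \<open>coord k\<close> gives the sign of \<open>e k\<close>,
  which cancels against the sign built into the tensor; the same happens with \<open>j\<close> in
  the summands over \<open>J\<close>. What remains is the part of \<open>\<delta>\<close> with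
  indices in \<open>insert j J\<close>.\<close>

lemma trace_form_contraction:
  assumes "j \<notin> J" "k \<in> J" "insert j J \<subseteq> I"
  shows "(\<Sum>A\<in>I. p (e A) (e A) * trace_form \<delta> j k J (e A) (e A) x)
      = (\<Sum>a\<in>insert j J. \<delta> (e a) * coord a x)"
proof -
  have jk: "j \<in> I" "k \<in> I" and "finite J"
    using assms finite_subset[OF _ finite_I] by auto
  let ?s = "\<lambda>j. \<Sum>A\<in>I. p (e A) (e A) * (coord j (e A) * coord j (e A))"
  have "(\<Sum>A\<in>I. p (e A) (e A) * trace_form \<delta> j k J (e A) (e A) x)
      = \<delta> (e j) * p (e k) (e k) * coord j x * ?s k +
        (\<Sum>A\<in>I. \<Sum>a\<in>J. \<delta> (e a) * p (e j) (e j) * coord a x *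
          (p (e A) (e A) * (coord j (e A) * coord j (e A))))"
    by (simp add: trace_form_def sq_tensor_def distrib_left sum.distrib sum_distrib_left
        algebra_simps)
  also have "(\<Sum>A\<in>I. \<Sum>a\<in>J. \<delta> (e a) * p (e j) (e j) * coord a x *
          (p (e A) (e A) * (coord j (e A) * coord j (e A))))
      = (\<Sum>a\<in>J. \<delta> (e a) * p (e j) (e j) * coord a x * ?s j)"
    by (subst sum.swap) (simp add: sum_distrib_left)
  also have "\<dots> = (\<Sum>a\<in>J. \<delta> (e a) * coord a x)"
    using unit[OF jk(1)] by (intro sum.cong) (auto simp: sum_coord_square jk)
  also have "\<delta> (e j) * p (e k) (e k) * coord j x * ?s k = \<delta> (e j) * coord j x"
    using unit[OF jk(2)] by (auto simp: sum_coord_square jk)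
  finally show ?thesis
    using assms(1) \<open>finite J\<close> by simp
qed

end

section \<open>The Dorfman bracket as a totally skew trilinear form\<close>

lemma bilinear_pairing: "bilinear pairing"
  unfolding bilinear_def pairing_def
  by (auto intro!: linearI simp: blinfun.bilinear_simps add_divide_distrib algebra_simps)

lemma pairing_commute: "pairing u w = pairing w u"
  by (simp add: pairing_def)

text \<open>Evaluates the \<open>Blinfun\<close> terms, which is legitimate because linear maps are
  bounded in finite dimension.\<close>

lemma pairing_dorfman:
  assumes "bilinear lie" "three_form H"
  shows "pairing (dorfman lie H u x) w = (1 / 2) * (H (fst u) (fst x) (fst w)
    - snd x (lie (fst u) (fst w)) + snd u (lie (fst x) (fst w)) + snd w (lie (fst u) (fst x)))"
proof -
  have bl: "bounded_linear (blinfun_apply \<eta> \<circ> lie a)" for \<eta> a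
    using assms(1)
    by (metis bilinear_def blinfun.bounded_linear_right linear_compose linear_conv_bounded_linear)
  have "blinfun_apply (ad_star lie a \<eta>) b = \<eta> (lie a b)" for a \<eta> b
    by (simp add: ad_star_def bounded_linear_Blinfun_apply[OF bl])
  moreover have "bounded_linear (H a b)" for a b
    using assms(2) by (simp add: three_form_def linear_conv_bounded_linear)
  ultimately show ?thesis
    by (simp add: pairing_def dorfman_def blinfun.bilinear_simps bounded_linear_Blinfun_apply)
qed

text \<open>Polarization: evaluate at a sum placed in both of the adjacent slots.\<close>

lemma three_form_skew:
  assumes "three_form H"
  shows "H y x z = - H x y z" "H x z y = - H x y z"
proof -
  have lin: "linear (\<lambda>x. H x y z)" "linear (\<lambda>y. H x y z)" "linear (\<lambda>z. H x y z)" for x y z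
    using assms by (auto simp: three_form_def)
  have 0: "H x x z = 0" "H z x x = 0" for x z
    using assms by (auto simp: three_form_def)
  show "H y x z = - H x y z"
    using 0(1)[of "x + y" z] unfolding linear_add[OF lin(1)] linear_add[OF lin(2)] by (simp add: 0)
  show "H x z y = - H x y z"
    using 0(2)[of x "y + z"] unfolding linear_add[OF lin(2)] linear_add[OF lin(3)] by (simp add: 0)
qed

text \<open>In the explicit formula each transposition permutes the four terms up to a common sign.
  The two transpositions generate all permutations, so the form is totally skew.\<close>

lemma pairing_dorfman_skew:
  assumes "lie_bracket lie" "three_form H"
  shows "pairing (dorfman lie H x u) w = - pairing (dorfman lie H u x) w"
    and "pairing (dorfman lie H u w) x = - pairing (dorfman lie H u x) w"
proof -
  have bil: "bilinear lie" and 0: "lie a a = 0" for a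
    using assms(1) by (auto simp: lie_bracket_def)
  have skew: "lie b a = - lie a b" for a b
    using 0[of "a + b"] unfolding bilinear_ladd[OF bil] bilinear_radd[OF bil]
    by (simp add: 0 eq_neg_iff_add_eq_0 add.commute)
  show "pairing (dorfman lie H x u) w = - pairing (dorfman lie H u x) w"
    by (simp add: pairing_dorfman[OF bil assms(2)] skew[of "fst u" "fst x"]
        three_form_skew(1)[OF assms(2), of "fst u" "fst x"] blinfun.minus_right algebra_simps)
  show "pairing (dorfman lie H u w) x = - pairing (dorfman lie H u x) w"
    by (simp add: pairing_dorfman[OF bil assms(2)] skew[of "fst x" "fst w"]
        three_form_skew(2)[OF assms(2), of _ "fst x" "fst w"] blinfun.minus_right algebra_simps)
qed

lemma trilinear_pairing_dorfman:
  assumes "bilinear lie" "three_form H"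
  shows "trilinear (\<lambda>u x w. pairing (dorfman lie H u x) w)"
proof -
  have H: "linear (\<lambda>x. H x y z)" "linear (\<lambda>y. H x y z)" "linear (\<lambda>z. H x y z)" for x y z
    using assms(2) by (auto simp: three_form_def)
  show ?thesis
    unfolding trilinear_def pairing_dorfman[OF assms]
    by (auto intro!: linearI simp: linear_add[OF H(1)] linear_add[OF H(2)] linear_add[OF H(3)]
        linear_scale[OF H(1)] linear_scale[OF H(2)] linear_scale[OF H(3)]
        bilinear_ladd[OF assms(1)] bilinear_radd[OF assms(1)]
        bilinear_lmul[OF assms(1)] bilinear_rmul[OF assms(1)]
        blinfun.bilinear_simps add_divide_distrib algebra_simps)
qed

section \<open>The eigenbundles and the frame of \<open>E\<close>\<close>

locale metric_frame =
  fixes g :: "'a::euclidean_space \<Rightarrow> 'a \<Rightarrow> real" and v :: "nat \<Rightarrow> 'a"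
  assumes metric: "pseudo_metric g" and basis: "orthonormal_basis g v"
begin

lemma indices_eq: "{1..2 * DIM('a)} = {1..DIM('a)} \<union> {DIM('a) + 1..2 * DIM('a)}"
  by auto

lemma linear_flat: "linear (flat g)"
proof -
  have lin: "linear (\<lambda>x. g x y)" for y
    using metric by (simp add: pseudo_metric_def bilinear_def)
  show ?thesis
    by (rule linearI; rule blinfun_eqI)
      (simp_all add: flat_apply[OF metric] linear_add[OF lin] linear_scale[OF lin]
        blinfun.bilinear_simps)
qed

lemma frame_plus: "A \<in> {1..DIM('a)} \<Longrightarrow> frame g v A = (v A, flat g (v A))"
  by (simp add: frame_def)

lemma frame_minus:
  "A \<in> {DIM('a) + 1..2 * DIM('a)} \<Longrightarrow> frame g v A = (v (A - DIM('a)), - flat g (v (A - DIM('a))))"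
  by (simp add: frame_def)

text \<open>Symmetry of \<open>g\<close> makes the eigenbundles orthogonal; conversely, testing
  against \<open>(y, - flat g y)\<close> recovers \<open>snd u = flat g (fst u)\<close>. In this
  form, preservation of an eigenbundle becomes the vanishing of a trilinear form.\<close>

lemma E_plus_iff: "u \<in> E_plus g \<longleftrightarrow> (\<forall>w\<in>E_minus g. pairing u w = 0)"
proof
  show "u \<in> E_plus g" if "\<forall>w\<in>E_minus g. pairing u w = 0"
  proof -
    have "snd u y = g y (fst u)" for y
      using that[rule_format, of "(y, - flat g y)"]
      by (auto simp: E_minus_def pairing_def flat_apply[OF metric] blinfun.bilinear_simps)
    then have "snd u = flat g (fst u)"
      using metric by (intro blinfun_eqI) (simp add: flat_apply[OF metric] pseudo_metric_def)
    then show ?thesis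
      by (auto simp: E_plus_def prod_eq_iff)
  qed
  show "\<forall>w\<in>E_minus g. pairing u w = 0" if "u \<in> E_plus g"
    using that metric
    by (auto simp: E_plus_def E_minus_def pairing_def flat_apply[OF metric]
        blinfun.bilinear_simps pseudo_metric_def)
qed

lemma E_minus_iff: "u \<in> E_minus g \<longleftrightarrow> (\<forall>w\<in>E_plus g. pairing u w = 0)"
proof
  show "u \<in> E_minus g" if "\<forall>w\<in>E_plus g. pairing u w = 0"
  proof -
    have "snd u y = - g y (fst u)" for y
      using that[rule_format, of "(y, flat g y)"]
      by (auto simp: E_plus_def pairing_def flat_apply[OF metric] blinfun.bilinear_simps)
    then have "snd u = - flat g (fst u)"
      using metric
      by (intro blinfun_eqI) (simp add: flat_apply[OF metric] pseudo_metric_def blinfun.bilinear_simps)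
    then show ?thesis
      by (auto simp: E_minus_def prod_eq_iff)
  qed
  show "\<forall>w\<in>E_plus g. pairing u w = 0" if "u \<in> E_minus g"
    using that E_plus_iff by (metis pairing_commute)
qed

lemma frame_in_E_plus: "A \<in> {1..DIM('a)} \<Longrightarrow> frame g v A \<in> E_plus g"
  by (auto simp: frame_plus E_plus_def)

lemma frame_in_E_minus: "A \<in> {DIM('a) + 1..2 * DIM('a)} \<Longrightarrow> frame g v A \<in> E_minus g"
  by (auto simp: frame_minus E_minus_def)

lemma pairing_plus_plus: "pairing (x, flat g x) (y, flat g y) = g x y"
  using metric by (simp add: pairing_def flat_apply[OF metric] pseudo_metric_def)

lemma pairing_minus_minus: "pairing (x, - flat g x) (y, - flat g y) = - g x y"
  using metric
  by (simp add: pairing_def flat_apply[OF metric] pseudo_metric_def blinfun.bilinear_simps)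

lemma span_frame: "span (frame g v ` {1..2 * DIM('a)}) = UNIV"
proof -
  let ?V = "v ` {1..DIM('a)}" and ?S = "span (frame g v ` {1..2 * DIM('a)})"
  have V: "span ?V = UNIV"
    using basis by (simp add: orthonormal_basis_def)
  have lin: "linear (\<lambda>x. (x, flat g x))" "linear (\<lambda>x. (x, - flat g x))"
    by (auto intro!: linearI simp: linear_add[OF linear_flat] linear_scale[OF linear_flat])
  have "(v a, flat g (v a)) \<in> ?S" if "a \<in> {1..DIM('a)}" for a
    using that frame_plus[OF that] by (intro span_base) (auto intro!: image_eqI[of _ _ a])
  then have plus: "(x, flat g x) \<in> ?S" for x
    using linear_span_image[OF lin(1), of ?V] span_minimal[of "(\<lambda>x. (x, flat g x)) ` ?V" ?S] V
    by (auto simp: image_subset_iff)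
  have "(v a, - flat g (v a)) \<in> ?S" if "a \<in> {1..DIM('a)}" for a
    using that frame_minus[of "a + DIM('a)"]
    by (intro span_base) (auto intro!: image_eqI[of _ _ "a + DIM('a)"])
  then have minus: "(x, - flat g x) \<in> ?S" for x
    using linear_span_image[OF lin(2), of ?V] span_minimal[of "(\<lambda>x. (x, - flat g x)) ` ?V" ?S] V
    by (auto simp: image_subset_iff)
  have "u \<in> ?S" for u
  proof -
    obtain y where y: "snd u = flat g y"
      using bij_flat[OF metric] by (metis bij_pointE)
    \<comment> \<open>Writing the covector as \<open>flat g y\<close>, the components in the two
      eigenbundles must satisfy \<open>a + b = fst u\<close> and \<open>a - b = y\<close>.\<close>
    define a b where "a = (1 / 2) *\<^sub>R (fst u + y)" and "b = (1 / 2) *\<^sub>R (fst u - y)"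
    have "a + b = fst u" "a - b = y"
      unfolding a_def b_def by (simp_all add: algebra_simps flip: scaleR_left.add)
    then have "u = (a, flat g a) + (b, - flat g b)"
      by (auto simp: prod_eq_iff y linear_diff[OF linear_flat])
    then show ?thesis
      by (metis plus minus span_add)
  qed
  then show ?thesis
    by auto
qed

text \<open>The two halves of the frame are orthogonal because the eigenbundles are; within a half
  the pairing is \<open>g\<close> or \<open>- g\<close> on the basis \<open>v\<close>.\<close>

sublocale orthonormal_frame pairing "frame g v" "{1..2 * DIM('a)}"
proof
  show "pairing u w = pairing w u" for u w :: "'a gen_tangent"
    by (rule pairing_commute)
  fix A assume A: "A \<in> {1..2 * DIM('a)}"
  have v: "a \<in> {1..DIM('a)} \<Longrightarrow> g (v a) (v a) = 1 \<or> g (v a) (v a) = -1"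
    "\<lbrakk>a \<in> {1..DIM('a)}; b \<in> {1..DIM('a)}; a \<noteq> b\<rbrakk> \<Longrightarrow> g (v a) (v b) = 0" for a b
    using basis by (auto simp: orthonormal_basis_def)
  have shift: "B - DIM('a) \<in> {1..DIM('a)}" if "B \<in> {DIM('a) + 1..2 * DIM('a)}" for B
    using that by auto
  show "pairing (frame g v A) (frame g v A) = 1 \<or> pairing (frame g v A) (frame g v A) = -1"
    using A v(1)[of A] v(1)[of "A - DIM('a)"] shift[of A] unfolding indices_eq
    by (auto simp: frame_def pairing_plus_plus pairing_minus_minus)
  fix B assume B: "B \<in> {1..2 * DIM('a)}" "A \<noteq> B"
  consider "A \<in> {1..DIM('a)}" "B \<in> {1..DIM('a)}" | "A \<in> {DIM('a) + 1..2 * DIM('a)}" "B \<in> {DIM('a) + 1..2 * DIM('a)}"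
    | "A \<in> {1..DIM('a)}" "B \<in> {DIM('a) + 1..2 * DIM('a)}" | "A \<in> {DIM('a) + 1..2 * DIM('a)}" "B \<in> {1..DIM('a)}"
    using A B unfolding indices_eq by blast
  then show "pairing (frame g v A) (frame g v B) = 0"
  proof cases
    case 1
    then show ?thesis
      using v(2)[of A B] B(2) by (simp add: frame_plus pairing_plus_plus)
  next
    case 2
    then have "A - DIM('a) \<noteq> B - DIM('a)"
      using B(2) by auto
    then show ?thesis
      using 2 v(2)[OF shift[OF 2(1)] shift[OF 2(2)]] by (simp add: frame_minus pairing_minus_minus)
  next
    case 3
    then show ?thesis
      using E_plus_iff frame_in_E_plus frame_in_E_minus by blast
  next
    case 4
    then show ?thesis
      using E_minus_iff frame_in_E_plus frame_in_E_minus by blast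
  qed
qed (rule bilinear_pairing finite_atLeastAtMost span_frame)+

lemma coframe_eq: "A \<in> {1..2 * DIM('a)} \<Longrightarrow> coframe g v A = coord A"
  by (intro ext) (simp only: coframe_def representation_frame)

lemma coord_E_minus: "\<lbrakk>u \<in> E_minus g; A \<in> {1..DIM('a)}\<rbrakk> \<Longrightarrow> coord A u = 0"
  using E_minus_iff frame_in_E_plus by (auto simp: coord_def)

lemma coord_E_plus: "\<lbrakk>u \<in> E_plus g; A \<in> {DIM('a) + 1..2 * DIM('a)}\<rbrakk> \<Longrightarrow> coord A u = 0"
  using E_plus_iff frame_in_E_minus by (auto simp: coord_def)

text \<open>The projections onto \<open>E_plus g\<close> along \<open>E_minus g\<close> and onto
  \<open>E_minus g\<close> along \<open>E_plus g\<close>.\<close>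

definition "P = proj {1..DIM('a)}"
definition "M = proj {DIM('a) + 1..2 * DIM('a)}"

lemma linear_P: "linear P" and linear_M: "linear M"
  unfolding P_def M_def by (rule linear_proj)+

lemma
  assumes "A \<in> {1..2 * DIM('a)}"
  shows P_frame: "P (frame g v A) = (if A \<in> {1..DIM('a)} then frame g v A else 0)"
    and M_frame: "M (frame g v A) = (if A \<in> {1..DIM('a)} then 0 else frame g v A)"
  using assms proj_frame[of "{1..DIM('a)}" A] proj_frame[of "{DIM('a) + 1..2 * DIM('a)}" A]
  by (auto simp: P_def M_def)

lemma P_add_M: "P u + M u = u"
  unfolding P_def M_def by (rule proj_add_proj[OF indices_eq]) auto

lemma
  assumes "u \<in> E_plus g"
  shows M_E_plus: "M u = 0" and P_E_plus: "P u = u"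
proof -
  show "M u = 0"
    unfolding M_def proj_def using assms by (intro sum.neutral) (simp add: coord_E_plus)
  then show "P u = u"
    using P_add_M[of u] by simp
qed

lemma
  assumes "u \<in> E_minus g"
  shows P_E_minus: "P u = 0" and M_E_minus: "M u = u"
proof -
  show "P u = 0"
    unfolding P_def proj_def using assms by (intro sum.neutral) (simp add: coord_E_minus)
  then show "M u = u"
    using P_add_M[of u] by simp
qed

section \<open>Connections studied through their trilinear forms\<close>

lemma pairing_adjoint:
  fixes f :: "'a gen_tangent \<Rightarrow> 'a gen_tangent"
  assumes "linear f"
  shows "pairing u (pairing_adjoint f w) = pairing (f u) w"
proof -
  have "linear (\<lambda>u. pairing (f u) w)" for w
    using linear_compose[OF assms linear_p_left] by (simp add: o_def)
  then have "\<exists>y. \<forall>u. pairing (f u) w = pairing u y" for w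
    by (metis riesz sym)
  then obtain h where h: "\<And>u w. pairing (f u) w = pairing u (h w)"
    by metis
  \<comment> \<open>Existence came from \<open>riesz\<close>; uniqueness is nondegeneracy, and
    together they resolve the definite description.\<close>
  have "pairing_adjoint f = h"
    unfolding pairing_adjoint_def
  proof (rule the_equality)
    fix f' assume f': "\<forall>u w. pairing (f u) w = pairing u (f' w)"
    show "f' = h"
      by (intro ext eqI_p) (metis f' h sym)
  qed (simp add: h)
  then show ?thesis
    by (simp add: h)
qed

lemma pairing_alt:
  fixes \<sigma> :: "'a gen_tangent \<Rightarrow> 'a gen_tangent \<Rightarrow> 'a gen_tangent \<Rightarrow> real"
  assumes "trilinear \<sigma>"
  shows "pairing (alt \<sigma> u x) w = \<sigma> u x w - \<sigma> u w x"
proof -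
  have "linear (\<lambda>w. \<sigma> u x w - \<sigma> u w x)"
    using assms unfolding trilinear_def by (intro linear_compose_sub) blast+
  then obtain y where y: "\<And>w. pairing y w = \<sigma> u x w - \<sigma> u w x"
    using riesz by blast
  have "alt \<sigma> u x = y"
    unfolding alt_def by (rule the_equality) (auto intro: eqI_p simp: y)
  then show ?thesis
    by (simp add: y)
qed

text \<open>Pairing the torsion with \<open>w\<close> gives
  \<open>\<tau> u x w - \<tau> x u w + \<tau> w u x\<close> minus the bracket term; skewness turns
  \<open>- \<tau> x u w\<close> into \<open>\<tau> x w u\<close>, so zero torsion is the cyclic
  identity. By orthogonality of the eigenbundles \<open>mixed\<close> preserves
  \<open>E_plus g\<close>, and with \<open>skew\<close> also \<open>E_minus g\<close>.\<close>

lemma levi_civita_divergence: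
  assumes form: "\<And>u x w. pairing (D u x) w = \<tau> u x w"
    and tri: "trilinear \<tau>"
    and skew: "\<And>u x w. \<tau> u w x = - \<tau> u x w"
    and cyclic: "\<And>u x w. \<tau> u x w + \<tau> x w u + \<tau> w u x = pairing (dorfman lie H u x) w"
    and mixed: "\<And>u x w. \<lbrakk>x \<in> E_plus g; w \<in> E_minus g\<rbrakk> \<Longrightarrow> \<tau> u x w = 0"
  shows "levi_civita lie H g D"
    and "divergence D x
      = (\<Sum>A\<in>{1..2 * DIM('a)}. frame_sign g v A * \<tau> (frame g v A) x (frame g v A))"
proof -
  have bil: "bilinear D"
    using bilinear_from_form[OF tri form] .
  then have lin: "linear (\<lambda>w. D w u)" for u
    unfolding bilinear_def by blast
  have "torsion lie H D u x = 0" for u x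
  proof (rule eqI_p)
    fix w
    have "pairing (pairing_adjoint (\<lambda>w. D w u) x) w = \<tau> w u x"
      by (subst sym) (simp add: pairing_adjoint[OF lin] form)
    then have "pairing (torsion lie H D u x) w
        = \<tau> u x w - \<tau> x u w - pairing (dorfman lie H u x) w + \<tau> w u x"
      unfolding torsion_def
      by (simp add: linear_add[OF linear_p_left] linear_diff[OF linear_p_left] form)
    also have "\<dots> = 0"
      using cyclic[of u x w] skew[of x u w] by simp
    finally show "pairing (torsion lie H D u x) w = pairing 0 w"
      by (simp add: linear_0[OF linear_p_left])
  qed
  moreover have "pairing (D u x) w = - pairing x (D u w)" for u x w
    using skew[of u x w] by (simp add: form sym[of x])
  moreover have "D u x \<in> E_plus g" if "x \<in> E_plus g" for u x
    using that mixed by (auto simp: E_plus_iff[of "D u x"] form)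
  moreover have "D u x \<in> E_minus g" if "x \<in> E_minus g" for u x
  proof -
    have "\<tau> u x w = 0" if "w \<in> E_plus g" for w
      using mixed[OF that \<open>x \<in> E_minus g\<close>] skew[of u x w] by simp
    then show ?thesis
      by (simp add: E_minus_iff[of "D u x"] form)
  qed
  ultimately show "levi_civita lie H g D"
    using bil by (auto simp: levi_civita_def gen_connection_def)
  show "divergence D x
      = (\<Sum>A\<in>{1..2 * DIM('a)}. frame_sign g v A * \<tau> (frame g v A) x (frame g v A))"
    by (simp add: divergence_def endo_trace_frame[OF lin] coord_def form frame_sign_def)
qed

section \<open>The canonical connection and its form\<close>

text \<open>The form of \<open>D\<^sup>0\<close>, with \<open>P\<close> and \<open>M\<close> in place of the index ranges of the frame.\<close>

definition canonical_form ::
  "('a gen_tangent \<Rightarrow> 'a gen_tangent \<Rightarrow> 'a gen_tangent \<Rightarrow> real) \<Rightarrow>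
   'a gen_tangent \<Rightarrow> 'a gen_tangent \<Rightarrow> 'a gen_tangent \<Rightarrow> real" where
  "canonical_form \<beta> u x w =
     (1 / 3) * \<beta> (P u) (P x) (P w) + (1 / 3) * \<beta> (M u) (M x) (M w) +
     \<beta> (M u) (P x) (P w) + \<beta> (P u) (M x) (M w)"

lemma trilinear_canonical_form:
  assumes "trilinear \<beta>"
  shows "trilinear (canonical_form \<beta>)"
  unfolding canonical_form_def
  by (intro trilinear_add trilinear_scale trilinear_compose[OF assms] linear_P linear_M)

text \<open>Expand \<open>\<beta>\<close> along \<open>P + M\<close>. The two pure terms occur in
  all three rotations, each time with weight 1/3. Each of the six mixed terms occurs in just one
  rotation, the one that puts first the argument whose projection differs from the other two, with
  weight 1.\<close>

lemma canonical_form_cyclic: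
  assumes tri: "trilinear \<beta>"
    and skew: "\<And>u x w. \<beta> x u w = - \<beta> u x w" "\<And>u x w. \<beta> u w x = - \<beta> u x w"
  shows "canonical_form \<beta> u x w + canonical_form \<beta> x w u + canonical_form \<beta> w u x = \<beta> u x w"
proof -
  have cyc: "\<beta> x w u = \<beta> u x w" for u x w
    using skew(1)[of u x w] skew(2)[of x u w] by simp
  have "\<beta> u x w = \<beta> (P u + M u) (P x + M x) (P w + M w)"
    by (simp only: P_add_M)
  also have "\<dots> = canonical_form \<beta> u x w + canonical_form \<beta> x w u + canonical_form \<beta> w u x"
    unfolding canonical_form_def
    using cyc[of "P x" "P w" "P u"] cyc[of "P w" "P u" "P x"]
      cyc[of "M x" "M w" "M u"] cyc[of "M w" "M u" "M x"]
      cyc[of "M x" "P w" "P u"] cyc[of "P x" "M w" "M u"]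
      cyc[of "P u" "P x" "M w"] cyc[of "M u" "M x" "P w"]
    unfolding trilinear_add_first[OF tri] trilinear_add_second[OF tri] trilinear_add_third[OF tri]
    by linarith
  finally show ?thesis ..
qed

text \<open>\<open>riesz_bilinear\<close> supplies a connection with this form, and uniqueness on
  the frame identifies it. On frame vectors \<open>P\<close> and \<open>M\<close> keep or kill each
  argument, so the surviving term is the matching case of \<open>canonical_coeff\<close>.\<close>

lemma pairing_canonical_connection:
  fixes lie H
  defines "\<beta> \<equiv> \<lambda>u x w. pairing (dorfman lie H u x) w"
  assumes tri: "trilinear \<beta>"
  shows "pairing (canonical_connection lie H g v u x) w = canonical_form \<beta> u x w"
proof -
  obtain D where D: "bilinear D" "\<And>u x w. pairing (D u x) w = canonical_form \<beta> u x w"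
    using riesz_bilinear[OF trilinear_canonical_form[OF tri]] by blast
  note 0 = trilinear_0_first[OF tri] trilinear_0_second[OF tri] trilinear_0_third[OF tri]
  have coeff: "pairing (D (frame g v A) (frame g v B)) (frame g v C)
      = canonical_coeff lie H g v A B C"
    if ABC: "A \<in> {1..2 * DIM('a)}" "B \<in> {1..2 * DIM('a)}" "C \<in> {1..2 * DIM('a)}" for A B C
  proof -
    have M: "X \<in> {DIM('a) + 1..2 * DIM('a)} \<longleftrightarrow> X \<notin> {1..DIM('a)}"
      if "X \<in> {1..2 * DIM('a)}" for X
      using that by auto
    have \<beta>: "dorfman_coeff lie H g v A B C = \<beta> (frame g v A) (frame g v B) (frame g v C)"
      by (simp add: dorfman_coeff_def \<beta>_def)
    show ?thesis
      unfolding D(2) canonical_form_def canonical_coeff_def Let_def \<beta>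
        P_frame[OF ABC(1)] P_frame[OF ABC(2)] P_frame[OF ABC(3)]
        M_frame[OF ABC(1)] M_frame[OF ABC(2)] M_frame[OF ABC(3)]
        M[OF ABC(1)] M[OF ABC(2)] M[OF ABC(3)]
      by (cases "A \<in> {1..DIM('a)}"; cases "B \<in> {1..DIM('a)}"; cases "C \<in> {1..DIM('a)}")
        (simp_all only: 0 simp_thms if_True if_False mult_zero_right add_0_left add_0_right)
  qed
  have "canonical_connection lie H g v = D"
    unfolding canonical_connection_def
  proof (rule the_equality)
    show "D' = D" if "bilinear D' \<and> (\<forall>A\<in>{1..2 * DIM('a)}. \<forall>B\<in>{1..2 * DIM('a)}. \<forall>C\<in>{1..2 * DIM('a)}.
        pairing (D' (frame g v A) (frame g v B)) (frame g v C) = canonical_coeff lie H g v A B C)" for D'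
      by (rule bilinear_eq_frame) (use that D(1) coeff in auto)
  qed (use D(1) coeff in blast)
  then show ?thesis
    by (simp add: D(2))
qed

text \<open>A frame vector lies in one eigenbundle, so one of its projections is zero and any
  remaining term has equal first and third arguments. This makes the canonical connection
  divergence-free.\<close>

lemma canonical_form_diagonal:
  assumes tri: "trilinear \<beta>" and skew: "\<And>u x w. \<beta> u w x = - \<beta> u x w" "\<And>u x w. \<beta> x u w = - \<beta> u x w"
    and A: "A \<in> {1..2 * DIM('a)}"
  shows "canonical_form \<beta> (frame g v A) x (frame g v A) = 0"
proof -
  have "\<beta> x w x = 0" for x w
    using skew(1)[of x x w] skew(2)[of x x w] by linarith
  note 0 = this trilinear_0_first[OF tri] trilinear_0_second[OF tri] trilinear_0_third[OF tri]
  consider "frame g v A \<in> E_plus g" | "frame g v A \<in> E_minus g"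
    using A frame_in_E_plus frame_in_E_minus unfolding indices_eq by blast
  then show ?thesis
    by cases (simp_all add: canonical_form_def 0 P_E_plus M_E_plus P_E_minus M_E_minus)
qed

end

section \<open>The form of \<open>D\<close>, its Levi-Civita property and its divergence\<close>

theorem proposition2p16:
  fixes lie :: "'a::euclidean_space \<Rightarrow> 'a \<Rightarrow> 'a"
    and H :: "'a \<Rightarrow> 'a \<Rightarrow> 'a \<Rightarrow> real"
    and g :: "'a \<Rightarrow> 'a \<Rightarrow> real"
    and v :: "nat \<Rightarrow> 'a"
    and \<delta> :: "'a gen_tangent \<Rightarrow> real"
  assumes "DIM('a) \<ge> 2"
    and "lie_bracket lie"
    and "closed_three_form lie H"
    and "pseudo_metric g"
    and "orthonormal_basis g v"
    and "linear \<delta>"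
  defines "S \<equiv> \<lambda>u x. S_plus g v \<delta> u x + S_minus g v \<delta> u x"
  defines "D \<equiv> \<lambda>u x. canonical_connection lie H g v u x + S u x"
  shows "levi_civita lie H g D \<and> divergence D = \<delta>"
proof -
  interpret metric_frame g v
    using \<open>pseudo_metric g\<close> \<open>orthonormal_basis g v\<close> by unfold_locales
  have H: "three_form H" and lie: "bilinear lie"
    using assms(2,3) unfolding closed_three_form_def lie_bracket_def by blast+
  let ?n = "DIM('a)" and ?e = "frame g v"
  define \<beta> where "\<beta> = (\<lambda>u x w. pairing (dorfman lie H u x) w)"
  have tri\<beta>: "trilinear \<beta>"
    using trilinear_pairing_dorfman[OF lie H] unfolding \<beta>_def .
  have skew\<beta>: "\<beta> x u w = - \<beta> u x w" "\<beta> u w x = - \<beta> u x w" for u x w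
    unfolding \<beta>_def by (rule pairing_dorfman_skew[OF \<open>lie_bracket lie\<close> H])+
  let ?J = "{2..?n}" and ?K = "{?n + 2..2 * ?n}"
  define \<sigma> where "\<sigma> = trace_form \<delta> 1 2 ?J"
  define \<rho> where "\<rho> = trace_form \<delta> (?n + 1) (?n + 2) ?K"
  have tri\<sigma>: "trilinear \<sigma>" and tri\<rho>: "trilinear \<rho>"
    unfolding \<sigma>_def \<rho>_def by (rule trilinear_trace_form)+
  \<comment> \<open>\<open>DIM('a) \<ge> 2\<close> provides, in each half of the frame, the second
    index \<open>k\<close> different from \<open>j\<close> that carries the component of
    \<open>\<delta>\<close> at \<open>j\<close>.\<close>
  have J: "1 \<notin> ?J" "2 \<in> ?J" "insert 1 ?J = {1..DIM('a)}"
    and K: "?n + 1 \<notin> ?K" "?n + 2 \<in> ?K" "insert (?n + 1) ?K = {DIM('a) + 1..2 * DIM('a)}"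
    using \<open>?n \<ge> 2\<close> by auto
  \<comment> \<open>All indices lie in the range of the frame, where \<open>coframe\<close> agrees
    with \<open>coord\<close>.\<close>
  have "S_plus g v \<delta> u x = - alt \<sigma> u x" for u x
  proof -
    have "\<sigma> = (\<lambda>u x w. \<delta> (?e 1) * frame_sign g v 2 * sq_tensor (coframe g v 2) (coframe g v 1) u x w
       + (\<Sum>a = 2..?n. \<delta> (?e a) * frame_sign g v 1 * sq_tensor (coframe g v 1) (coframe g v a) u x w))"
      using \<open>?n \<ge> 2\<close> by (simp add: \<sigma>_def trace_form_def fun_eq_iff frame_sign_def coframe_eq)
    then show ?thesis
      by (simp add: S_plus_def Let_def)
  qed
  then have S_plus: "pairing (S_plus g v \<delta> u x) w = - (\<sigma> u x w - \<sigma> u w x)" for u x w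
    by (simp add: linear_neg[OF linear_p_left] pairing_alt[OF tri\<sigma>])
  have "S_minus g v \<delta> u x = - alt \<rho> u x" for u x
  proof -
    have "\<rho> = (\<lambda>u x w. \<delta> (?e (?n + 1)) * frame_sign g v (?n + 2)
         * sq_tensor (coframe g v (?n + 2)) (coframe g v (?n + 1)) u x w
       + (\<Sum>i = ?n + 2..2 * ?n. \<delta> (?e i) * frame_sign g v (?n + 1)
         * sq_tensor (coframe g v (?n + 1)) (coframe g v i) u x w))"
      using \<open>?n \<ge> 2\<close> by (simp add: \<rho>_def trace_form_def fun_eq_iff frame_sign_def coframe_eq)
    then show ?thesis
      by (simp add: S_minus_def Let_def)
  qed
  then have S_minus: "pairing (S_minus g v \<delta> u x) w = - (\<rho> u x w - \<rho> u w x)" for u x w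
    by (simp add: linear_neg[OF linear_p_left] pairing_alt[OF tri\<rho>])
  \<comment> \<open>The minus sign before \<open>alt\<close> reverses the difference; the shape
    \<open>+ -\<close> fits the closure lemmas for trilinear forms.\<close>
  define \<tau> where "\<tau> u x w = canonical_form \<beta> u x w
      + ((\<sigma> u w x + - \<sigma> u x w) + (\<rho> u w x + - \<rho> u x w))" for u x w
  have "pairing (canonical_connection lie H g v u x) w = canonical_form \<beta> u x w" for u x w
    using pairing_canonical_connection[of lie H] tri\<beta> unfolding \<beta>_def by blast
  then have form: "pairing (D u x) w = \<tau> u x w" for u x w
    by (simp add: D_def S_def \<tau>_def linear_add[OF linear_p_left] S_plus S_minus)
  have tri: "trilinear \<tau>"
    unfolding \<tau>_def
    by (intro trilinear_add trilinear_minus trilinear_canonical_form tri\<beta> tri\<sigma> tri\<rho>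
        trilinear_swap[OF tri\<sigma>] trilinear_swap[OF tri\<rho>])
  have skew: "\<tau> u w x = - \<tau> u x w" for u x w
    by (simp add: \<tau>_def canonical_form_def skew\<beta>(2)[of _ "P x" "P w"] skew\<beta>(2)[of _ "M x" "M w"])
  have sym: "\<sigma> u x w = \<sigma> x u w" "\<rho> u x w = \<rho> x u w" for u x w
    unfolding \<sigma>_def \<rho>_def by (rule trace_form_commute)+
  \<comment> \<open>By \<open>sym\<close> the six terms of \<open>\<sigma>\<close> in the cyclic sum
    cancel in pairs, and likewise those of \<open>\<rho>\<close>.\<close>
  have cyclic: "\<tau> u x w + \<tau> x w u + \<tau> w u x = pairing (dorfman lie H u x) w" for u x w
    using canonical_form_cyclic[OF tri\<beta> skew\<beta>, of u x w]
      sym[of u x w] sym[of x w u] sym[of w u x]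
    by (simp add: \<tau>_def \<beta>_def)
  have mixed: "\<tau> u x w = 0" if "x \<in> E_plus g" "w \<in> E_minus g" for u x w
  proof -
    \<comment> \<open>\<open>\<sigma>\<close> is built from coordinates that vanish on
      \<open>E_minus g\<close>, hence at \<open>w\<close>, and \<open>\<rho>\<close> from ones that
      vanish on \<open>E_plus g\<close>, hence at \<open>x\<close>. Every term of
      \<open>canonical_form\<close> contains \<open>P w\<close> or \<open>M x\<close>, both
      zero.\<close>
    have "\<sigma> u w x = 0" "\<sigma> u x w = 0"
      unfolding \<sigma>_def using J coord_E_minus[OF that(2)] trace_form_eq_0[of 2 ?J 1 w] by auto
    moreover have "\<rho> u x w = 0" "\<rho> u w x = 0"
      unfolding \<rho>_def
      using K coord_E_plus[OF that(1)] trace_form_eq_0[of "?n + 2" ?K "?n + 1" x] by auto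
    ultimately show ?thesis
      using that
      by (simp add: \<tau>_def canonical_form_def P_E_plus M_E_plus P_E_minus M_E_minus
          trilinear_0_second[OF tri\<beta>] trilinear_0_third[OF tri\<beta>])
  qed
  have LC: "levi_civita lie H g D"
    by (rule levi_civita_divergence(1)[OF form tri skew cyclic mixed])
  have div: "divergence D x = (\<Sum>A\<in>{1..2 * ?n}. frame_sign g v A * \<tau> (?e A) x (?e A))" for x
    by (rule levi_civita_divergence(2)[OF form tri skew cyclic mixed])
  have "divergence D x = \<delta> x" for x
  proof -
    have sub: "insert 1 ?J \<subseteq> {1..2 * ?n}" "insert (?n + 1) ?K \<subseteq> {1..2 * ?n}"
      using \<open>?n \<ge> 2\<close> by auto
    \<comment> \<open>Of the alternated terms only those with \<open>?e A\<close> in the first two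
      slots survive; the others vanish off the diagonal, and the canonical part vanishes by
      skewness.\<close>
    have "divergence D x
        = (\<Sum>A\<in>{1..2 * ?n}. pairing (?e A) (?e A) * \<sigma> (?e A) (?e A) x)
        + (\<Sum>A\<in>{1..2 * ?n}. pairing (?e A) (?e A) * \<rho> (?e A) (?e A) x)"
      unfolding div sum.distrib[symmetric]
    proof (rule sum.cong)
      fix A assume A: "A \<in> {1..2 * ?n}"
      have "\<sigma> (?e A) x (?e A) = 0" "\<rho> (?e A) x (?e A) = 0"
        unfolding \<sigma>_def \<rho>_def
        using trace_form_off_diagonal[OF J(1,2) sub(1) A] trace_form_off_diagonal[OF K(1,2) sub(2) A]
        by auto
      then show "frame_sign g v A * \<tau> (?e A) x (?e A)
          = pairing (?e A) (?e A) * \<sigma> (?e A) (?e A) x + pairing (?e A) (?e A) * \<rho> (?e A) (?e A) x"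
        using canonical_form_diagonal[OF tri\<beta> skew\<beta>(2,1) A]
        by (simp add: \<tau>_def frame_sign_def distrib_left)
    qed simp
    also have "\<dots> = (\<Sum>a\<in>{1..DIM('a)}. \<delta> (?e a) * coord a x)
        + (\<Sum>a\<in>{DIM('a) + 1..2 * DIM('a)}. \<delta> (?e a) * coord a x)"
      unfolding \<sigma>_def \<rho>_def trace_form_contraction[OF J(1,2) sub(1)]
        trace_form_contraction[OF K(1,2) sub(2)] J(3) K(3) ..
    \<comment> \<open>The contractions contribute the two halves of the frame expansion of
      \<open>\<delta>\<close>.\<close>
    also have "\<dots> = (\<Sum>a\<in>{1..2 * ?n}. coord a x *\<^sub>R \<delta> (?e a))"
      unfolding indices_eq by (subst sum.union_disjoint) (auto simp: mult.commute)
    also have "\<dots> = \<delta> x"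
      by (rule linear_expansion[OF \<open>linear \<delta>\<close>, symmetric])
    finally show ?thesis .
  qed
  with LC show ?thesis
    by auto
qed

end
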